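(* Let $A,B\in\mathcal{H}_n(\Gamma)$ have the same graph $G$ (that is, $G_A=G_B=G$), and let $F$ be a maximal forest of $G$. Then $A$ and $B$ are switching equivalent if and only if $\zeta_A(C)=\zeta_B(C)$ for each cycle $C\in\mathcal{B}_F(G)$.
   Context: $\Gamma\subset\mathbb{C}$ is a set such that $0\in\Gamma$ and $\Gamma\setminus\{0\}$ is a subgroup of the multiplicative group of complex numbers of unit modulus. $\mathcal{H}_n(\Gamma)$ is the set of all $n\times n$ Hermitian matrices with entries in $\Gamma$ and zero diagonal. For $A=[a_{uv}]\in\mathcal{H}_n(\Gamma)$, the graph $G_A$ of $A$ is the simple undirected graph with vertex set $\{1,\dots,n\}$ in which $u,v$ are adjacent iff $a_{uv}\neq 0$. For a cycle $C=u_1u_2\ldots u_ku_1$ in $G_A$ (taken with a fixed direction of traversal), the gain of $C$ is $\zeta_A(C)=a_{u_1u_2}a_{u_2u_3}\cdots a_{u_{k-1}u_k}a_{u_ku_1}$; when gains of a cycle with respect to two matrices are compared, the same direction is used for both. Matrices $A,B\in\mathcal{H}_n(\Gamma)$ are switching equivalent, $A\sim B$, if there is a function $\theta:\{1,\dots,n\}\to\Gamma\setminus\{0\}$ with $D(\theta)^{-1}AD(\theta)=B$, where $D(\theta)=\mathrm{diag}[\theta(1),\dots,\theta(n)]$. A maximal forest $F$ of $G$ is a spanning subgraph of $G$ consisting of a spanning tree of each component of $G$. For $e\in E(G)\setminus E(F)$, $C_F(e)$ is the unique cycle in $F\cup\{e\}$, and $\mathcal{B}_F(G)=\{C_F(e):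 e\in E(G)\setminus E(F)\}$ (the fundamental cycle basis of $G$ with respect to $F$). *)

theory Defs
  imports "HOL-Analysis.Analysis" "HOL-Algebra.Group"
begin

section \<open>Simple undirected graphs\<close>

text \<open>
  A graph is a pair of a vertex set and a set of edges, an edge being a two-element vertex set.
\<close>

type_synonym 'v sgraph = "'v set \<times> 'v set set"

abbreviation gverts :: "'v sgraph \<Rightarrow> 'v set" where
  "gverts G \<equiv> fst G"

abbreviation gedges :: "'v sgraph \<Rightarrow> 'v set set" where
  "gedges G \<equiv> snd G"

definition adjacent :: "'v sgraph \<Rightarrow> 'v \<Rightarrow> 'v \<Rightarrow> bool" where
  "adjacent G u v \<longleftrightarrow> {u, v} \<in> gedges G"

definition connected_graph :: "'v sgraph \<Rightarrow> bool" where
  "connected_graph G \<longleftrightarrow>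
     gverts G \<noteq> {} \<and> (\<forall>u\<in>gverts G. \<forall>v\<in>gverts G. (adjacent G)\<^sup>*\<^sup>* u v)"

definition induced :: "'v sgraph \<Rightarrow> 'v set \<Rightarrow> 'v sgraph" where
  "induced G K = (K, {e \<in> gedges G. e \<subseteq> K})"

definition graph_components :: "'v sgraph \<Rightarrow> 'v sgraph set" where
  "graph_components G =
     (\<lambda>u. induced G {v \<in> gverts G. (adjacent G)\<^sup>*\<^sup>* u v}) ` gverts G"

text \<open>
  A cycle, as a subgraph, is given by its edge set (it has no isolated vertices).  A vertex list
  \<open>[u\<^sub>1, \<dots>, u\<^sub>k]\<close> with \<open>traverses [u\<^sub>1, \<dots>, u\<^sub>k] C\<close> amounts to
  writing \<open>C = u\<^sub>1u\<^sub>2\<dots>u\<^sub>ku\<^sub>1\<close>; it fixes a direction of traversal and a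
  starting vertex of \<open>C\<close>.
\<close>

definition traverses :: "'v list \<Rightarrow> 'v set set \<Rightarrow> bool" where
  "traverses us C \<longleftrightarrow> 3 \<le> length us \<and> distinct us \<and>
     C = {{us ! i, us ! (Suc i mod length us)} | i. i < length us}"

definition cycle_of :: "'v sgraph \<Rightarrow> 'v set set \<Rightarrow> bool" where
  "cycle_of G C \<longleftrightarrow> C \<subseteq> gedges G \<and> (\<exists>us. traverses us C)"

definition tree_graph :: "'v sgraph \<Rightarrow> bool" where
  "tree_graph T \<longleftrightarrow> connected_graph T \<and> \<not> (\<exists>C. cycle_of T C)"

definition spanning_subgraph :: "'v sgraph \<Rightarrow> 'v sgraph \<Rightarrow> bool" where
  "spanning_subgraph H G \<longleftrightarrow> gverts H = gverts G \<and> gedges H \<subseteq> gedges G"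

definition spanning_tree :: "'v sgraph \<Rightarrow> 'v sgraph \<Rightarrow> bool" where
  "spanning_tree T G \<longleftrightarrow> tree_graph T \<and> spanning_subgraph T G"

definition maximal_forest :: "'v sgraph \<Rightarrow> 'v sgraph \<Rightarrow> bool" where
  "maximal_forest F G \<longleftrightarrow> spanning_subgraph F G \<and>
     (\<forall>K\<in>graph_components G. spanning_tree (induced F (gverts K)) K)"

definition fundamental_cycle :: "'v sgraph \<Rightarrow> 'v set \<Rightarrow> 'v set set" where
  "fundamental_cycle F e = (THE C. cycle_of (gverts F, insert e (gedges F)) C)"

definition fundamental_cycle_basis :: "'v sgraph \<Rightarrow> 'v sgraph \<Rightarrow> 'v set set set" where
  "fundamental_cycle_basis F G = fundamental_cycle F ` (gedges G - gedges F)"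

section \<open>Hermitian matrices over unit complex numbers\<close>

definition circle_group :: "complex monoid" where
  "circle_group = \<lparr>carrier = {z. norm z = 1}, mult = (*), one = 1\<rparr>"

definition hermitian_matrices :: "complex set \<Rightarrow> (complex^'n^'n) set" where
  "hermitian_matrices \<Gamma> =
     {A. (\<forall>u v. A $ u $ v \<in> \<Gamma>) \<and> (\<forall>u v. A $ v $ u = cnj (A $ u $ v)) \<and> (\<forall>u. A $ u $ u = 0)}"

text \<open>
  For a Hermitian matrix with zero diagonal this is a simple graph, and
  \<open>A $ u $ v \<noteq> 0\<close> does not depend on the order of \<open>u\<close> and \<open>v\<close>.
\<close>

definition matrix_graph :: "complex^'n^'n \<Rightarrow> 'n sgraph" where
  "matrix_graph A = (UNIV, {{u, v} | u v. A $ u $ v \<noteq> 0})"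

definition gain :: "complex^'n^'n \<Rightarrow> 'n list \<Rightarrow> complex" where
  "gain A us = (\<Prod>i<length us. A $ (us ! i) $ (us ! (Suc i mod length us)))"

definition diag_matrix :: "('n \<Rightarrow> complex) \<Rightarrow> complex^'n^'n" where
  "diag_matrix \<theta> = (\<chi> i j. if i = j then \<theta> i else 0)"

definition switching_equivalent ::
    "complex set \<Rightarrow> complex^'n::finite^'n \<Rightarrow> complex^'n^'n \<Rightarrow> bool" where
  "switching_equivalent \<Gamma> A B \<longleftrightarrow>
     (\<exists>\<theta>. (\<forall>u. \<theta> u \<in> \<Gamma> - {0}) \<and>
        matrix_inv (diag_matrix \<theta>) ** A ** diag_matrix \<theta> = B)"

end

theory Submission
  imports Defs
begin

text \<open>
  Switching by \<open>\<theta>\<close> multiplies the entry at \<open>(u, v)\<close> by \<open>\<theta> v / \<theta> u\<close>, and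
  along a closed walk these factors cancel.  So switching preserves all gains
  (\<open>gain_switch\<close>), which is one direction.

  For the converse, seek \<open>\<theta>\<close> with \<open>\<theta> v = \<theta> u * (B $ u $ v / A $ u $ v)\<close> for all
  edges \<open>{u, v}\<close>, that is, a potential for the ratio of the two matrices.  On a forest there
  is no obstruction to a potential (\<open>forest_potential\<close>).  Switching \<open>A\<close> by it makes
  \<open>A\<close> agree with \<open>B\<close> on the edges of \<open>F\<close> and leaves the gains unchanged.  An edge
  \<open>e\<close> outside \<open>F\<close> is traversed exactly once by its fundamental cycle, whose other edges
  are in \<open>F\<close>; all factors of the two gains other than the one at \<open>e\<close> coincide and are
  nonzero, so equality of the gains forces agreement at \<open>e\<close> as well.

  The graph theory that this rests on is the correctness of the fundamental cycle: adding \<open>e\<close>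
  to \<open>F\<close> creates one and only one cycle.  Both this and the existence of potentials are
  derived from two facts that link cycles with reachability: joining two distinct,
  nonadjacent but connected vertices creates a cycle (\<open>connected_nonadjacent_cycle\<close>), and
  deleting an edge of a cycle leaves its ends connected (\<open>cycle_minus_edge_connects\<close>).
\<close>

section \<open>Cycles and reachability\<close>

text \<open>
  Walks have to be shortened to paths since a cycle is traversed by a list without repetitions.
\<close>

lemma reachable_distinct_path:
  assumes "(adjacent G)\<^sup>*\<^sup>* a b"
  shows "\<exists>p. p \<noteq> [] \<and> distinct p \<and> hd p = a \<and> last p = b \<and>
    (\<forall>i. Suc i < length p \<longrightarrow> {p ! i, p ! Suc i} \<in> gedges G)"
  using assms
proof (induction rule: rtranclp_induct)
  case base
  show ?case by (rule exI[of _ "[a]"]) auto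
next
  case (step y z)
  then obtain p where p: "p \<noteq> []" "distinct p" "hd p = a" "last p = y"
    "\<And>i. Suc i < length p \<Longrightarrow> {p ! i, p ! Suc i} \<in> gedges G" by blast
  show ?case
  proof (cases "z \<in> set p")
    case True
    \<comment> \<open>The walk returns to \<open>z\<close>: drop the detour.\<close>
    then obtain k where k: "k < length p" "p ! k = z" by (auto simp: in_set_conv_nth)
    let ?q = "take (Suc k) p"
    have "last ?q = z" using k by (simp add: take_Suc_conv_app_nth)
    moreover have "hd ?q = a" using p by (cases p) auto
    ultimately show ?thesis using p k by (intro exI[of _ ?q]) auto
  next
    case False
    have "{(p @ [z]) ! i, (p @ [z]) ! Suc i} \<in> gedges G" if "Suc i < length (p @ [z])" for i
    proof (cases "Suc i < length p")
      case True
      then show ?thesis using p(5) by (simp add: nth_append)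
    next
      case no: False
      with that have "i = length p - 1" "Suc i = length p" by auto
      then have "(p @ [z]) ! i = y" "(p @ [z]) ! Suc i = z"
        using p(1,4) by (auto simp: nth_append last_conv_nth)
      then show ?thesis using step.hyps(2) by (simp add: adjacent_def)
    qed
    then show ?thesis using p False by (intro exI[of _ "p @ [z]"]) auto
  qed
qed

lemma connected_nonadjacent_cycle:
  assumes "(adjacent (V, E))\<^sup>*\<^sup>* a b" and "a \<noteq> b" and "{a, b} \<notin> E"
  shows "\<exists>C. cycle_of (W, insert {a, b} E) C"
proof -
  obtain p where p: "p \<noteq> []" "distinct p" "hd p = a" "last p = b"
    "\<And>i. Suc i < length p \<Longrightarrow> {p ! i, p ! Suc i} \<in> E"
    using reachable_distinct_path[OF assms(1)] by auto
  let ?k = "length p"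
  have ends: "p ! 0 = a" "p ! (?k - 1) = b" using p by (auto simp: hd_conv_nth last_conv_nth)
  have "?k \<noteq> 0" "?k \<noteq> 1" using p(1) ends assms(2) by auto
  moreover have "?k \<noteq> 2"
  proof
    assume "?k = 2"
    then show False using p(5)[of 0] ends assms(3) by simp
  qed
  ultimately have k: "3 \<le> ?k" by linarith
  define C where "C = {{p ! i, p ! (Suc i mod ?k)} | i. i < ?k}"
  have "{p ! i, p ! (Suc i mod ?k)} \<in> insert {a, b} E" if "i < ?k" for i
  proof (cases "Suc i < ?k")
    case True
    then show ?thesis using p(5) by simp
  next
    case False
    then have "i = ?k - 1" "Suc i mod ?k = 0" using that by (auto simp: mod_if)
    then show ?thesis using ends by (simp add: insert_commute)
  qed
  then have "C \<subseteq> insert {a, b} E" unfolding C_def by blast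
  moreover have "traverses p C" using k p(2) by (auto simp: traverses_def C_def)
  ultimately show ?thesis by (auto simp: cycle_of_def)
qed

text \<open>
  A traversal passes each edge of its cycle only once.  This needs length at least three: the
  closed walk \<open>u v u\<close> passes \<open>{u, v}\<close> twice.
\<close>

lemma traversal_edge_inj:
  assumes "distinct us" and "3 \<le> length us" and "i < length us" and "j < length us"
    and "{us ! i, us ! (Suc i mod length us)} = {us ! j, us ! (Suc j mod length us)}"
  shows "i = j"
proof -
  let ?k = "length us"
  have "0 < ?k" using assms(2) by linarith
  then have "Suc i mod ?k < ?k" "Suc j mod ?k < ?k" by (rule mod_less_divisor)+
  then have "i = j \<or> (i = Suc j mod ?k \<and> Suc i mod ?k = j)"
    using assms by (auto simp: doubleton_eq_iff nth_eq_iff_index_eq)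
  then show ?thesis using assms(2-4) by (auto simp: mod_Suc split: if_splits)
qed

lemma symp_adjacent: "symp (adjacent G)"
  by (auto simp: symp_def adjacent_def insert_commute)

lemma reachable_sym: "(adjacent G)\<^sup>*\<^sup>* u v \<Longrightarrow> (adjacent G)\<^sup>*\<^sup>* v u"
  using symp_rtranclp[OF symp_adjacent] by (rule sympD)

lemma reachable_mono:
  assumes "(adjacent (V, E))\<^sup>*\<^sup>* u v" and "E \<subseteq> E'"
  shows "(adjacent (V', E'))\<^sup>*\<^sup>* u v"
  using assms(1) by (rule rtranclp_mono[THEN predicate2D, rotated])
    (use assms(2) in \<open>auto simp: adjacent_def\<close>)

lemma cycle_minus_edge_connects:
  assumes "traverses us C" and "{x, y} \<in> C"
  shows "(adjacent (V, C - {{x, y}}))\<^sup>*\<^sup>* x y"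
proof -
  let ?k = "length us" and ?R = "(adjacent (V, C - {{x, y}}))\<^sup>*\<^sup>*"
  have us: "3 \<le> ?k" "distinct us" and C: "C = {{us ! i, us ! (Suc i mod ?k)} | i. i < ?k}"
    using assms(1) by (auto simp: traverses_def)
  obtain i where i: "i < ?k" "{x, y} = {us ! i, us ! (Suc i mod ?k)}" using assms(2) C by blast
  \<comment> \<open>Go round the cycle the long way, starting just behind the deleted edge.\<close>
  have walk: "?R (us ! (Suc i mod ?k)) (us ! ((Suc i + j) mod ?k))" if "j < ?k" for j
    using that
  proof (induction j)
    case 0
    show ?case by simp
  next
    case (Suc j)
    let ?m = "(Suc i + j) mod ?k"
    have m: "?m < ?k" using i(1) by (intro mod_less_divisor) linarith
    have next_m: "Suc ?m mod ?k = (Suc i + Suc j) mod ?k" by (simp add: mod_Suc_eq)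
    have "?m \<noteq> i"
      using i(1) Suc.prems by (cases "Suc i + j < ?k") (auto simp: mod_if)
    then have "{us ! ?m, us ! (Suc ?m mod ?k)} \<noteq> {x, y}"
      using traversal_edge_inj[OF us(2,1) m i(1)] i(2) by metis
    moreover have "{us ! ?m, us ! (Suc ?m mod ?k)} \<in> C" using m C by blast
    ultimately have "adjacent (V, C - {{x, y}}) (us ! ?m) (us ! ((Suc i + Suc j) mod ?k))"
      unfolding adjacent_def next_m by simp
    then show ?case using Suc by (meson Suc_lessD rtranclp.rtrancl_into_rtrancl)
  qed
  have "Suc i + (?k - 1) = i + ?k" using us(1) by linarith
  then have "(Suc i + (?k - 1)) mod ?k = i" using i(1) by simp
  then have "?R (us ! (Suc i mod ?k)) (us ! i)" using walk[of "?k - 1"] us(1) by simp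
  then show ?thesis using i(2) reachable_sym by (metis doubleton_eq_iff)
qed

section \<open>The fundamental cycle of an edge\<close>

text \<open>
  Suppose that \<open>f\<close> were an edge of \<open>C\<^sub>1\<close> but not of \<open>C\<^sub>2\<close>.  The rest of \<open>C\<^sub>1\<close> connects
  the ends of \<open>f\<close> and, since \<open>C\<^sub>2\<close> supplies a detour around \<open>e\<close> that avoids \<open>f\<close>, they
  are connected in \<open>E - {f}\<close>.  Then \<open>f\<close> would lie on a cycle in \<open>E\<close>.
\<close>

lemma cycle_through_new_edge_subset:
  assumes acyclic: "\<nexists>C. cycle_of (V, E) C" and two: "\<And>f. f \<in> E \<Longrightarrow> \<exists>x y. f = {x, y} \<and> x \<noteq> y"
    and C1: "cycle_of (V, insert {a, b} E) C\<^sub>1" and C2: "cycle_of (V, insert {a, b} E) C\<^sub>2"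
  shows "C\<^sub>1 \<subseteq> C\<^sub>2"
proof
  fix f assume f: "f \<in> C\<^sub>1"
  show "f \<in> C\<^sub>2"
  proof (rule ccontr)
    assume nf: "f \<notin> C\<^sub>2"
    obtain us1 us2 where t: "traverses us1 C\<^sub>1" "traverses us2 C\<^sub>2"
      and sub: "C\<^sub>1 \<subseteq> insert {a, b} E" "C\<^sub>2 \<subseteq> insert {a, b} E"
      using C1 C2 by (auto simp: cycle_of_def)
    have ab: "{a, b} \<in> C\<^sub>2"
    proof (rule ccontr)
      assume "{a, b} \<notin> C\<^sub>2"
      then have "cycle_of (V, E) C\<^sub>2" using sub t by (auto simp: cycle_of_def)
      then show False using acyclic by blast
    qed
    then have fE: "f \<in> E" using f nf sub by auto
    then obtain x y where xy: "f = {x, y}" "x \<noteq> y" using two by blast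
    let ?R = "(adjacent (V, E - {f}))\<^sup>*\<^sup>*"
    have detour: "?R a b"
      using cycle_minus_edge_connects[OF t(2) ab] by (rule reachable_mono) (use sub nf in auto)
    have "(adjacent (V, C\<^sub>1 - {{x, y}}))\<^sup>*\<^sup>* x y"
      using cycle_minus_edge_connects[OF t(1)] f xy by blast
    then have "?R x y"
    proof (induction rule: rtranclp_induct)
      case base
      show ?case by simp
    next
      case (step u v)
      then have "{u, v} \<in> insert {a, b} E - {f}" using sub xy by (auto simp: adjacent_def)
      then consider "{u, v} = {a, b}" | "adjacent (V, E - {f}) u v"
        by (auto simp: adjacent_def)
      then have "?R u v"
      proof cases
        case 1
        then show ?thesis
          using detour reachable_sym[OF detour] by (auto simp: doubleton_eq_iff)
      qed (rule r_into_rtranclp)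
      then show ?case using step.IH by simp
    qed
    then have "\<exists>C. cycle_of (V, insert {x, y} (E - {f})) C"
      using xy by (intro connected_nonadjacent_cycle) auto
    moreover have "insert {x, y} (E - {f}) = E" using fE xy by auto
    ultimately show False using acyclic by simp
  qed
qed

text \<open>
  By the preceding inclusion, applied in both directions, the cycle created by \<open>{a, b}\<close> is
  unique, so the definite description that defines the fundamental cycle denotes it.
\<close>

lemma fundamental_cycle_is_cycle:
  assumes acyclic: "\<nexists>C. cycle_of F C"
    and two: "\<And>f. f \<in> gedges F \<Longrightarrow> \<exists>x y. f = {x, y} \<and> x \<noteq> y"
    and conn: "(adjacent F)\<^sup>*\<^sup>* a b" and "a \<noteq> b" and "{a, b} \<notin> gedges F"
  shows "cycle_of (gverts F, insert {a, b} (gedges F)) (fundamental_cycle F {a, b})"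
    and "{a, b} \<in> fundamental_cycle F {a, b}"
proof -
  obtain V E where F: "F = (V, E)" by (cases F)
  obtain C where C: "cycle_of (V, insert {a, b} E) C"
    using connected_nonadjacent_cycle[of V E a b V] assms F by auto
  have unique: "C' = C" if "cycle_of (V, insert {a, b} E) C'" for C'
    using cycle_through_new_edge_subset[of V E a b] acyclic two C that F by (intro equalityI) auto
  have eq: "fundamental_cycle F {a, b} = C"
    unfolding fundamental_cycle_def F fst_conv snd_conv using C unique by (rule the_equality)
  show "cycle_of (gverts F, insert {a, b} (gedges F)) (fundamental_cycle F {a, b})"
    using C F eq by simp
  show "{a, b} \<in> fundamental_cycle F {a, b}"
    using C F eq acyclic by (auto simp: cycle_of_def)
qed

section \<open>Maximal forests\<close>

text \<open>
  Maximal forests are specified one component at a time; the next two lemmas turn this into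
  statements about the whole graph.  A cycle is connected, so it lies inside one component,
  where it is excluded.
\<close>

lemma maximal_forest_acyclic:
  assumes F: "maximal_forest F G" and wf: "\<Union> (gedges G) \<subseteq> gverts G"
  shows "\<nexists>C. cycle_of F C"
proof
  assume "\<exists>C. cycle_of F C"
  then obtain C us where C: "C \<subseteq> gedges F" and t: "traverses us C" by (auto simp: cycle_of_def)
  let ?k = "length us"
  have us: "3 \<le> ?k" and Cdef: "C = {{us ! i, us ! (Suc i mod ?k)} | i. i < ?k}"
    using t by (auto simp: traverses_def)
  have FG: "gedges F \<subseteq> gedges G" using F by (auto simp: maximal_forest_def spanning_subgraph_def)
  have edge: "{us ! i, us ! (Suc i mod ?k)} \<in> gedges G" if "i < ?k" for i
    using that C FG Cdef by blast
  define K where "K = {v \<in> gverts G. (adjacent G)\<^sup>*\<^sup>* (us ! 0) v}"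
  have inK: "us ! i \<in> K" if "i < ?k" for i
    using that
  proof (induction i)
    case 0
    then show ?case using edge[of 0] wf by (auto simp: K_def)
  next
    case (Suc i)
    then have e: "{us ! i, us ! Suc i} \<in> gedges G" using edge[of i] by simp
    moreover have "(adjacent G)\<^sup>*\<^sup>* (us ! 0) (us ! i)" using Suc by (simp add: K_def)
    ultimately have "(adjacent G)\<^sup>*\<^sup>* (us ! 0) (us ! Suc i)"
      by (simp add: adjacent_def rtranclp.rtrancl_into_rtrancl)
    then show ?case using e wf by (auto simp: K_def)
  qed
  have "0 < ?k" using us by linarith
  then have "us ! 0 \<in> gverts G" using inK[of 0] unfolding K_def by blast
  then have "induced G K \<in> graph_components G" by (auto simp: graph_components_def K_def)
  then have "\<nexists>C. cycle_of (induced F K) C"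
    using F by (auto simp: maximal_forest_def spanning_tree_def tree_graph_def induced_def)
  moreover have "C \<subseteq> gedges (induced F K)"
  proof
    fix e assume e: "e \<in> C"
    then obtain i where "i < ?k" "e = {us ! i, us ! (Suc i mod ?k)}" using Cdef by blast
    moreover have "Suc i mod ?k < ?k" using \<open>0 < ?k\<close> by (rule mod_less_divisor)
    ultimately show "e \<in> gedges (induced F K)" using inK e C by (auto simp: induced_def)
  qed
  ultimately show False using t by (auto simp: cycle_of_def)
qed

lemma maximal_forest_connects_adjacent:
  assumes F: "maximal_forest F G" and wf: "\<Union> (gedges G) \<subseteq> gverts G" and e: "{a, b} \<in> gedges G"
  shows "(adjacent F)\<^sup>*\<^sup>* a b"
proof -
  define K where "K = {v \<in> gverts G. (adjacent G)\<^sup>*\<^sup>* a v}"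
  have ab: "a \<in> K" "b \<in> K" using e wf by (auto simp: K_def adjacent_def)
  have "a \<in> gverts G" using e wf by auto
  then have "induced G K \<in> graph_components G" by (auto simp: graph_components_def K_def)
  then have "connected_graph (induced F K)"
    using F by (auto simp: maximal_forest_def spanning_tree_def tree_graph_def induced_def)
  then have "(adjacent (induced F K))\<^sup>*\<^sup>* a b"
    using ab by (auto simp: connected_graph_def induced_def)
  then have "(adjacent (gverts F, gedges F))\<^sup>*\<^sup>* a b"
    unfolding induced_def by (rule reachable_mono) auto
  then show ?thesis by simp
qed

text \<open>
  The forest is built up edge by edge.  A new edge \<open>{a, b}\<close> joins two different components,
  and rescaling the potential by a constant on the component of \<open>b\<close> adjusts it to the new
  edge without violating the condition at the old ones.
\<close>

lemma forest_potential:
  fixes q :: "'v \<Rightarrow> 'v \<Rightarrow> 'a::field"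
  assumes "finite E" and "\<nexists>C. cycle_of (V, E) C"
    and "\<And>e. e \<in> E \<Longrightarrow> \<exists>x y. e = {x, y} \<and> x \<noteq> y"
    and S: "1 \<in> S" "\<And>x y. x \<in> S \<Longrightarrow> y \<in> S \<Longrightarrow> x * y \<in> S" "\<And>x. x \<in> S \<Longrightarrow> inverse x \<in> S" "0 \<notin> S"
    and "\<And>u v. {u, v} \<in> E \<Longrightarrow> q u v \<in> S"
    and "\<And>u v. {u, v} \<in> E \<Longrightarrow> q u v * q v u = 1"
  shows "\<exists>\<theta>. (\<forall>u. \<theta> u \<in> S) \<and> (\<forall>u v. {u, v} \<in> E \<longrightarrow> \<theta> v = \<theta> u * q u v)"
  using assms(1-3,8,9)
proof (induction E rule: finite_induct)
  case empty
  show ?case using S(1) by (intro exI[of _ "\<lambda>_. 1"]) auto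
next
  case (insert e E)
  have acyclic: "\<nexists>C. cycle_of (V, E) C" using insert.prems(1) by (auto simp: cycle_of_def)
  obtain \<theta> where \<theta>: "\<And>u. \<theta> u \<in> S" "\<And>u v. {u, v} \<in> E \<Longrightarrow> \<theta> v = \<theta> u * q u v"
    using insert.IH[OF acyclic] insert.prems(2-4) by auto
  obtain a b where ab: "e = {a, b}" "a \<noteq> b" using insert.prems(2)[of e] by auto
  have \<theta>nz: "\<theta> u \<noteq> 0" for u using \<theta>(1)[of u] S(4) by metis
  let ?R = "(adjacent (V, E))\<^sup>*\<^sup>*"
  have sep: "\<not> ?R b a"
  proof
    assume "?R b a"
    then have "\<exists>C. cycle_of (V, insert {a, b} E) C"
      using reachable_sym ab insert.hyps(2) by (intro connected_nonadjacent_cycle) auto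
    then show False using insert.prems(1) ab(1) by simp
  qed
  define c where "c = \<theta> a * q a b * inverse (\<theta> b)"
  define \<theta>' where "\<theta>' u = (if ?R b u then \<theta> u * c else \<theta> u)" for u
  have qS: "q a b \<in> S" and q1: "q a b * q b a = 1" using insert.prems(3,4) ab by auto
  have "c \<in> S" unfolding c_def using S \<theta>(1) qS by blast
  then have "\<theta>' u \<in> S" for u using S(2) \<theta>(1) by (auto simp: \<theta>'_def)
  moreover have "\<theta>' v = \<theta>' u * q u v" if uv: "{u, v} \<in> insert e E" for u v
  proof (cases "{u, v} \<in> E")
    case True
    then have "adjacent (V, E) u v" "adjacent (V, E) v u"
      by (auto simp: adjacent_def insert_commute)
    then have "?R b u \<longleftrightarrow> ?R b v" by (meson rtranclp.rtrancl_into_rtrancl)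
    then show ?thesis using \<theta>(2)[OF True] by (auto simp: \<theta>'_def)
  next
    case False
    have a': "\<theta>' a = \<theta> a" and b': "\<theta>' b = \<theta> a * q a b"
      using sep \<theta>nz[of b] by (auto simp: \<theta>'_def c_def)
    have "u = a \<and> v = b \<or> u = b \<and> v = a" using False uv ab by (auto simp: doubleton_eq_iff)
    then show ?thesis using a' b' q1 by (auto simp: mult.assoc)
  qed
  ultimately show ?case by blast
qed

section \<open>Switching and gains\<close>

lemma hermitian_matricesD:
  assumes "A \<in> hermitian_matrices \<Gamma>"
  shows "A $ u $ v \<in> \<Gamma>" and "A $ v $ u = cnj (A $ u $ v)" and "A $ u $ u = 0"
  using assms unfolding hermitian_matrices_def by blast+

lemma edge_matrix_graph_iff:
  assumes "A \<in> hermitian_matrices \<Gamma>"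
  shows "{u, v} \<in> gedges (matrix_graph A) \<longleftrightarrow> A $ u $ v \<noteq> 0"
proof -
  have "A $ v $ u \<noteq> 0 \<longleftrightarrow> A $ u $ v \<noteq> 0"
    using hermitian_matricesD(2)[OF assms, of v u] by simp
  then show ?thesis
    unfolding matrix_graph_def snd_conv mem_Collect_eq doubleton_eq_iff by blast
qed

lemma matrix_inv_diag_matrix:
  fixes \<theta> :: "'n::finite \<Rightarrow> complex"
  assumes "\<And>u. \<theta> u \<noteq> 0"
  shows "matrix_inv (diag_matrix \<theta>) = diag_matrix (\<lambda>u. inverse (\<theta> u))"
proof -
  let ?D = "diag_matrix \<theta>" and ?D' = "diag_matrix (\<lambda>u. inverse (\<theta> u))"
  have inv: "?D ** ?D' = mat 1" "?D' ** ?D = mat 1"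
    using assms
    by (auto simp: vec_eq_iff matrix_matrix_mult_def diag_matrix_def mat_def
        if_distrib[of "\<lambda>x. x * _"] cong: if_cong)
  have "matrix_inv ?D ** ?D = mat 1"
    unfolding matrix_inv_def
    using someI[of "\<lambda>M. ?D ** M = mat 1 \<and> M ** ?D = mat 1" ?D'] inv by simp
  then have "matrix_inv ?D ** (?D ** ?D') = ?D'"
    by (simp add: matrix_mul_assoc)
  then show ?thesis by (simp add: inv)
qed

lemma switch_entry:
  fixes A :: "complex^'n::finite^'n"
  assumes "\<And>u. \<theta> u \<noteq> 0"
  shows "(matrix_inv (diag_matrix \<theta>) ** A ** diag_matrix \<theta>) $ u $ v
    = inverse (\<theta> u) * A $ u $ v * \<theta> v"
  unfolding matrix_inv_diag_matrix[OF assms]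
  by (simp add: matrix_matrix_mult_def diag_matrix_def if_distrib[of "\<lambda>x. x * _"]
      if_distrib[of "\<lambda>x. _ * x"] cong: if_cong)

lemma prod_cyclic_shift:
  fixes f :: "nat \<Rightarrow> 'a::comm_monoid_mult"
  shows "(\<Prod>i<k. f (Suc i mod k)) = (\<Prod>i<k. f i)"
proof (cases k)
  case 0
  then show ?thesis by simp
next
  case (Suc m)
  have "(\<Prod>i<k. f (Suc i mod k)) = (\<Prod>i<m. f (Suc i)) * f 0" using Suc by simp
  also have "\<dots> = (\<Prod>i<k. f i)"
    unfolding Suc by (simp only: prod.lessThan_Suc_shift mult.commute)
  finally show ?thesis .
qed

text \<open>
  The closed walk leaves each vertex as often as it enters it, so the factors \<open>inverse (\<theta> u)\<close>
  and \<open>\<theta> u\<close> cancel.  This holds for every closed walk, cycle or not.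
\<close>

lemma gain_switch:
  fixes A A' :: "complex^'n::finite^'n"
  assumes "\<And>u. \<theta> u \<noteq> 0" and "\<And>u v. A' $ u $ v = inverse (\<theta> u) * A $ u $ v * \<theta> v"
  shows "gain A' us = gain A us"
proof -
  let ?k = "length us"
  have "gain A' us = (\<Prod>i<?k. inverse (\<theta> (us ! i))) * gain A us
      * (\<Prod>i<?k. \<theta> (us ! (Suc i mod ?k)))"
    by (simp add: gain_def assms(2) prod.distrib)
  also have "\<dots> = (\<Prod>i<?k. inverse (\<theta> (us ! i)) * \<theta> (us ! i)) * gain A us"
    by (simp add: prod_cyclic_shift[of "\<lambda>i. \<theta> (us ! i)"] prod.distrib mult_ac)
  finally show ?thesis using assms(1) by simp
qed

text \<open>
  Cancel the common nonzero factors; a single entry remains on each side, because the edge is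
  passed only once.  The traversal may pass it in either direction, hence the disjunction; for
  Hermitian matrices the two alternatives are equivalent.
\<close>

lemma equal_gain_forces_entry:
  fixes A B :: "complex^'n::finite^'n"
  assumes t: "traverses us C" and e: "{a, b} \<in> C" and "gain A us = gain B us"
    and agree: "\<And>u v. {u, v} \<in> C - {{a, b}} \<Longrightarrow> A $ u $ v = B $ u $ v \<and> B $ u $ v \<noteq> 0"
  shows "A $ a $ b = B $ a $ b \<or> A $ b $ a = B $ b $ a"
proof -
  let ?k = "length us"
  have us: "3 \<le> ?k" "distinct us" and C: "C = {{us ! i, us ! (Suc i mod ?k)} | i. i < ?k}"
    using t by (auto simp: traverses_def)
  obtain i where i: "i < ?k" "{a, b} = {us ! i, us ! (Suc i mod ?k)}" using e C by blast
  have other: "{us ! j, us ! (Suc j mod ?k)} \<in> C - {{a, b}}" if "j \<in> {..<?k} - {i}" for j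
    using that traversal_edge_inj[OF us(2,1) i(1), of j] i(2) C by auto
  have split_gain: "gain M us = M $ (us ! i) $ (us ! (Suc i mod ?k)) *
      (\<Prod>j\<in>{..<?k} - {i}. M $ (us ! j) $ (us ! (Suc j mod ?k)))" for M :: "complex^'n^'n"
    unfolding gain_def using i(1) by (intro prod.remove) auto
  have "(\<Prod>j\<in>{..<?k} - {i}. A $ (us ! j) $ (us ! (Suc j mod ?k)))
      = (\<Prod>j\<in>{..<?k} - {i}. B $ (us ! j) $ (us ! (Suc j mod ?k)))"
    using agree[OF other] by (intro prod.cong) auto
  moreover have "(\<Prod>j\<in>{..<?k} - {i}. B $ (us ! j) $ (us ! (Suc j mod ?k))) \<noteq> 0"
    using agree[OF other] by auto
  ultimately have "A $ (us ! i) $ (us ! (Suc i mod ?k)) = B $ (us ! i) $ (us ! (Suc i mod ?k))"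
    using assms(3) split_gain[of A] split_gain[of B] by simp
  then show ?thesis using i(2) by (auto simp: doubleton_eq_iff)
qed

section \<open>Switching equivalence is decided on the fundamental cycles\<close>

theorem theorem2p2:
  fixes \<Gamma> :: "complex set"
    and A B :: "complex^'n::finite^'n"
    and G F :: "'n sgraph"
    and traversal :: "'n set set \<Rightarrow> 'n list"
  assumes "0 \<in> \<Gamma>" and "subgroup (\<Gamma> - {0}) circle_group"
    and "A \<in> hermitian_matrices \<Gamma>" and "B \<in> hermitian_matrices \<Gamma>"
    and "matrix_graph A = G" and "matrix_graph B = G"
    and "maximal_forest F G"
    and "\<And>C. C \<in> fundamental_cycle_basis F G \<Longrightarrow> traverses (traversal C) C"
  shows "switching_equivalent \<Gamma> A B \<longleftrightarrow>
    (\<forall>C\<in>fundamental_cycle_basis F G. gain A (traversal C) = gain B (traversal C))"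
proof
  assume "switching_equivalent \<Gamma> A B"
  then obtain \<theta> where "\<forall>u. \<theta> u \<in> \<Gamma> - {0}"
    and B: "matrix_inv (diag_matrix \<theta>) ** A ** diag_matrix \<theta> = B"
    unfolding switching_equivalent_def by (elim exE conjE)
  then have nz: "\<theta> u \<noteq> 0" for u by blast
  have "gain B us = gain A us" for us
    by (rule gain_switch[of \<theta>, OF nz]) (simp only: B[symmetric] switch_entry[OF nz])
  then show "\<forall>C\<in>fundamental_cycle_basis F G. gain A (traversal C) = gain B (traversal C)"
    by simp
next
  assume gains: "\<forall>C\<in>fundamental_cycle_basis F G. gain A (traversal C) = gain B (traversal C)"
  let ?S = "\<Gamma> - {0}"
  have unit: "norm z = 1" if "z \<in> ?S" for z
    using subgroup.subset[OF assms(2)] that by (auto simp: circle_group_def)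
  have cnj_inverse: "cnj z = inverse z" if "z \<in> ?S" for z
    using unit[OF that] complex_norm_square[of z] by (intro inverse_unique[symmetric]) simp
  have S1: "1 \<in> ?S"
    using subgroup.one_closed[OF assms(2)] by (simp add: circle_group_def)
  have Sm: "x * y \<in> ?S" if "x \<in> ?S" "y \<in> ?S" for x y
    using subgroup.m_closed[OF assms(2) that] by (simp add: circle_group_def)
  have Si: "inverse x \<in> ?S" if x: "x \<in> ?S" for x
  proof -
    have "monoid circle_group"
      by unfold_locales (auto simp: circle_group_def norm_mult)
    moreover have "inverse x \<in> carrier circle_group" "x \<in> carrier circle_group" "x \<noteq> 0"
      using unit[OF x] x by (auto simp: circle_group_def norm_inverse)
    ultimately have "inv\<^bsub>circle_group\<^esub> x = inverse x"
      by (intro monoid.inv_unique'[symmetric]) (auto simp: circle_group_def)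
    then show ?thesis using subgroup.m_inv_closed[OF assms(2) x] by simp
  qed
  have A\<Gamma>: "A $ u $ v \<in> \<Gamma>" and Ah: "A $ v $ u = cnj (A $ u $ v)" and A0: "A $ u $ u = 0" for u v
    using hermitian_matricesD[OF assms(3)] by blast+
  have B\<Gamma>: "B $ u $ v \<in> \<Gamma>" and Bh: "B $ v $ u = cnj (B $ u $ v)" for u v
    using hermitian_matricesD[OF assms(4)] by blast+
  have GA: "{u, v} \<in> gedges G \<longleftrightarrow> A $ u $ v \<noteq> 0" for u v
    using edge_matrix_graph_iff[OF assms(3)] assms(5) by simp
  have GB: "{u, v} \<in> gedges G \<longleftrightarrow> B $ u $ v \<noteq> 0" for u v
    using edge_matrix_graph_iff[OF assms(4)] assms(6) by simp
  have wf: "\<Union> (gedges G) \<subseteq> gverts G" using assms(5) by (auto simp: matrix_graph_def)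
  have FG: "gedges F \<subseteq> gedges G"
    using assms(7) by (auto simp: maximal_forest_def spanning_subgraph_def)
  have twoG: "\<exists>x y. e = {x, y} \<and> x \<noteq> y" if e: "e \<in> gedges G" for e
  proof -
    obtain x y where "e = {x, y}" "A $ x $ y \<noteq> 0"
      using e assms(5) by (auto simp: matrix_graph_def)
    then show ?thesis using A0 by metis
  qed
  have acyclic: "\<nexists>C. cycle_of F C" using maximal_forest_acyclic[OF assms(7) wf] .
  \<comment> \<open>The factor by which switching has to change the entry at an edge \<open>{u, v}\<close>; on unit
    numbers conjugation is inversion, so being Hermitian makes \<open>q v u\<close> the inverse of \<open>q u v\<close>.\<close>
  define q where "q u v = B $ u $ v * inverse (A $ u $ v)" for u v
  have "\<exists>\<theta>. (\<forall>u. \<theta> u \<in> ?S) \<and> (\<forall>u v. {u, v} \<in> gedges F \<longrightarrow> \<theta> v = \<theta> u * q u v)"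
  proof (rule forest_potential[of "gedges F" "gverts F"])
    show "q u v \<in> ?S" if "{u, v} \<in> gedges F" for u v
    proof -
      have "{u, v} \<in> gedges G" using that FG by blast
      then show ?thesis unfolding q_def using A\<Gamma> B\<Gamma> GA GB by (intro Sm Si) auto
    qed
    show "q u v * q v u = 1" if "{u, v} \<in> gedges F" for u v
    proof -
      have "{u, v} \<in> gedges G" using that FG by blast
      then have nz: "A $ u $ v \<in> ?S" "B $ u $ v \<in> ?S" using A\<Gamma> B\<Gamma> GA GB by auto
      then have "A $ v $ u = inverse (A $ u $ v)" "B $ v $ u = inverse (B $ u $ v)"
        by (simp_all only: Ah[of v u] Bh[of v u] cnj_inverse)
      then show ?thesis using nz by (simp add: q_def field_simps)
    qed
  qed (use S1 Sm Si acyclic twoG FG in auto)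
  then obtain \<theta> where \<theta>S: "\<And>u. \<theta> u \<in> ?S"
    and \<theta>: "\<And>u v. {u, v} \<in> gedges F \<Longrightarrow> \<theta> v = \<theta> u * q u v" by blast
  have nz: "\<theta> u \<noteq> 0" for u using \<theta>S[of u] by simp
  define A' where "A' = matrix_inv (diag_matrix \<theta>) ** A ** diag_matrix \<theta>"
  have A': "A' $ u $ v = inverse (\<theta> u) * A $ u $ v * \<theta> v" for u v
    unfolding A'_def using switch_entry nz by blast
  have A'h: "A' $ v $ u = cnj (A' $ u $ v)" for u v
    using cnj_inverse[OF \<theta>S] by (simp add: A' Ah[of v u] mult_ac)
  have onF: "A' $ u $ v = B $ u $ v" if "{u, v} \<in> gedges F" for u v
  proof -
    have "A $ u $ v \<noteq> 0" using that FG GA by blast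
    then show ?thesis using nz[of u] by (simp add: A' \<theta>[OF that] q_def field_simps)
  qed
  have "A' $ u $ v = B $ u $ v" for u v
  proof (cases "{u, v} \<in> gedges G")
    case False
    then show ?thesis using GA GB by (simp add: A')
  next
    case G: True
    show ?thesis
    proof (cases "{u, v} \<in> gedges F")
      case True
      then show ?thesis by (rule onF)
    next
      case False
      let ?C = "fundamental_cycle F {u, v}"
      have "u \<noteq> v" using G GA A0 by metis
      then have C: "cycle_of (gverts F, insert {u, v} (gedges F)) ?C" "{u, v} \<in> ?C"
        using fundamental_cycle_is_cycle[of F u v] acyclic twoG FG False
          maximal_forest_connects_adjacent[OF assms(7) wf G] by blast+
      have basis: "?C \<in> fundamental_cycle_basis F G"
        using G False by (auto simp: fundamental_cycle_basis_def)
      have "gain A' (traversal ?C) = gain B (traversal ?C)"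
        using gain_switch[OF nz A'] gains basis by simp
      moreover have "A' $ x $ y = B $ x $ y \<and> B $ x $ y \<noteq> 0" if "{x, y} \<in> ?C - {{u, v}}" for x y
      proof -
        have "{x, y} \<in> gedges F" using that C(1) by (auto simp: cycle_of_def)
        then show ?thesis using onF FG GB by blast
      qed
      ultimately have "A' $ u $ v = B $ u $ v \<or> A' $ v $ u = B $ v $ u"
        using equal_gain_forces_entry[OF assms(8)[OF basis] C(2)] by blast
      then show ?thesis using A'h[of u v] Bh[of u v] by auto
    qed
  qed
  then have "A' = B" by (simp add: vec_eq_iff)
  then show "switching_equivalent \<Gamma> A B"
    unfolding switching_equivalent_def A'_def using \<theta>S by blast
qed

end
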